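(* Let $G=(V,E)$ be a finite connected Eulerian directed multigraph and let $\alpha$ be a probability distribution on $V$ with $\alpha_j>0$ for all $j\in V$. For an initial sandpile $s_0:V\to\mathbb{Z}$ let $(s_k)_{k\ge0}$ be the closed chain started at $s_0$ and driven by the i.i.d. sequence $i_1,i_2,\ldots$ with law $\alpha$, and let $\tau=\min\{k\ge0: s_k\text{ is not stabilizable}\}$. Then for each $i\in V$, as $|s_0|\to-\infty$, $$\mathbb{P}_{s_0}\{i_\tau=i\}\;\to\;\alpha_i.$$
   Context: Graph and Laplacian. $G=(V,E)$ is a finite directed graph, multiple edges permitted, connected and Eulerian: each vertex $i$ has the same number $\deg(i)$ of incoming edges as outgoing edges. For $u:V\to\mathbb{Z}$, $\Delta u(i)=-\deg(i)u(i)+\sum_e u(e^-)$, the sum being over edges $e$ coming into $i$, with $e^-$ the other endpoint (tail) of $e$. $\delta_i(j)=\mathbf{1}\{i=j\}$. Sandpiles. A sandpile is a function $s:V\to\mathbb{Z}$ (negative values allowed); $|s|=\sum_{i\in V}s(i)$. Vertex $i$ is unstable if $s(i)\ge\deg(i)$; toppling an unstable vertex $i$ replaces $s$ by $s+\Delta\delta_i$. $s$ is stabilizable if some finite (possibly empty) sequence of topplings of unstable vertices leads to a sandpile $\mathcal{S}(s)\le\deg-1$ (coordinatewise); $\mathcal{S}(s)$ does not depend on the sequence chosen. Closed chain. For $i\in V$, $a_i s=\mathcal{S}(s+\delta_i)$ if $s+\delta_i$ is stabilizable, and $a_i s=s+\delta_i$ otherwise. Let $i_1,i_2,\ldots$ be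 independent random vertices with law $\alpha$. The closed chain started from a sandpile $s_0$ is $s_k=a_{i_k}s_{k-1}$ for $k\ge1$. $\mathbb{P}_{s_0}$ is the law of the process with initial state $s_0$. Limit. "$F(s_0)\to L$ as $|s_0|\to-\infty$" means: for every $\epsilon>0$ there is $K<0$ such that $|F(s_0)-L|\le\epsilon$ for every $s_0:V\to\mathbb{Z}$ with $|s_0|<K$. *)

theory Defs
  imports "Graph_Theory.Graph_Theory" "HOL-Probability.Probability"
begin

text \<open>A digraph \<open>G\<close> may have multiple arcs and loops. A sandpile is a function
  \<open>'v \<Rightarrow> int\<close>, of which only the values on \<^term>\<open>verts G\<close> matter: toppling and adding
  a grain at a vertex of \<open>G\<close> do not change the values elsewhere.\<close>

definition eulerian :: "('v, 'e) pre_digraph \<Rightarrow> bool" where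
  "eulerian G \<longleftrightarrow> (\<forall>v \<in> verts G. in_degree G v = out_degree G v)"

definition laplacian :: "('v, 'e) pre_digraph \<Rightarrow> ('v \<Rightarrow> int) \<Rightarrow> 'v \<Rightarrow> int" where
  "laplacian G u i = - int (out_degree G i) * u i + (\<Sum>e \<in> in_arcs G i. u (tail G e))"

definition delta :: "'v \<Rightarrow> 'v \<Rightarrow> int" where
  "delta i j = (if i = j then 1 else 0)"

definition mass :: "('v, 'e) pre_digraph \<Rightarrow> ('v \<Rightarrow> int) \<Rightarrow> int" where
  "mass G s = (\<Sum>i \<in> verts G. s i)"

definition stable :: "('v, 'e) pre_digraph \<Rightarrow> ('v \<Rightarrow> int) \<Rightarrow> bool" where
  "stable G s \<longleftrightarrow> (\<forall>i \<in> verts G. s i \<le> int (out_degree G i) - 1)"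

definition topples :: "('v, 'e) pre_digraph \<Rightarrow> ('v \<Rightarrow> int) \<Rightarrow> ('v \<Rightarrow> int) \<Rightarrow> bool" where
  "topples G s t \<longleftrightarrow>
     (\<exists>i \<in> verts G. int (out_degree G i) \<le> s i \<and> t = (\<lambda>j. s j + laplacian G (delta i) j))"

definition stabilizable :: "('v, 'e) pre_digraph \<Rightarrow> ('v \<Rightarrow> int) \<Rightarrow> bool" where
  "stabilizable G s \<longleftrightarrow> (\<exists>t. (topples G)\<^sup>*\<^sup>* s t \<and> stable G t)"

definition stabilization :: "('v, 'e) pre_digraph \<Rightarrow> ('v \<Rightarrow> int) \<Rightarrow> 'v \<Rightarrow> int" where
  "stabilization G s = (THE t. (topples G)\<^sup>*\<^sup>* s t \<and> stable G t)"

definition add_grain :: "('v, 'e) pre_digraph \<Rightarrow> 'v \<Rightarrow> ('v \<Rightarrow> int) \<Rightarrow> 'v \<Rightarrow> int" where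
  "add_grain G i s =
     (let s' = (\<lambda>j. s j + delta i j)
      in if stabilizable G s' then stabilization G s' else s')"

text \<open>The driving sequence is indexed from 1; its entry at index 0 is never used.\<close>

primrec closed_chain ::
  "('v, 'e) pre_digraph \<Rightarrow> ('v \<Rightarrow> int) \<Rightarrow> (nat \<Rightarrow> 'v) \<Rightarrow> nat \<Rightarrow> 'v \<Rightarrow> int" where
  "closed_chain G s\<^sub>0 x 0 = s\<^sub>0"
| "closed_chain G s\<^sub>0 x (Suc k) = add_grain G (x (Suc k)) (closed_chain G s\<^sub>0 x k)"

text \<open>The threshold time is \<open>\<infinity>\<close> if every state of the chain is stabilizable.\<close>

definition threshold_time ::
  "('v, 'e) pre_digraph \<Rightarrow> ('v \<Rightarrow> int) \<Rightarrow> (nat \<Rightarrow> 'v) \<Rightarrow> enat" where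
  "threshold_time G s\<^sub>0 x = Inf {enat k | k. \<not> stabilizable G (closed_chain G s\<^sub>0 x k)}"

end

theory Submission
  imports Defs "HOL-Library.Confluence"
begin

text \<open>
Let \<open>X\<^sub>k\<close> be the sum of the first \<open>k\<close> grains and write
\<open>p\<^sub>k(s)\<close> for the probability that \<open>s + X\<^sub>k\<close> is stabilizable. Topplings commute, so the
\<open>k\<close>-th state of the chain is stabilizable exactly if \<open>s + X\<^sub>k\<close> is, and \<open>p\<^sub>k(s)\<close> is the
probability that \<open>\<tau> > k\<close>. Put \<open>T(s) = \<Sum>\<^sub>k p\<^sub>k(s)\<close>, the mean of \<open>\<tau>\<close>.

The grain that destroys stabilizability falls on \<open>i\<close> at time \<open>k + 1\<close> if and only if
\<open>s + X\<^sub>k\<close> is stabilizable, \<open>s + \<delta>\<^sub>i + X\<^sub>k\<close> is not, and \<open>i\<close> is drawn at that time. The last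
condition is independent of the first two, and stabilizability is monotone, so
\<open>P(i\<^sub>\<tau> = i) = \<alpha>\<^sub>i \<Sum>\<^sub>k (p\<^sub>k(s) - p\<^sub>k(s + \<delta>\<^sub>i)) = \<alpha>\<^sub>i (T(s) - T(s + \<delta>\<^sub>i))\<close>
(lemma \<open>prob_epicenter\<close>).

Each grain raises the mass by one and topplings preserve it. Hence \<open>\<mu>(s) = |s| + T(s)\<close> is the
mean mass at the threshold. It is bounded, because negative mass forces stabilizability while large
mass excludes it, and as long as the mass is negative it is harmonic:
\<open>\<mu>(s) = \<Sum>\<^sub>j \<alpha>\<^sub>j \<mu>(s + \<delta>\<^sub>j)\<close>. In terms of \<open>\<mu>\<close>,
\<open>P(i\<^sub>\<tau> = i) - \<alpha>\<^sub>i = - \<alpha>\<^sub>i (\<mu>(s + \<delta>\<^sub>i) - \<mu>(s))\<close>.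

So it remains to see that the increments of a bounded harmonic function vanish far from the
threshold (lemma \<open>harmonic_increment_bound\<close>). Along the random walk \<open>\<mu>\<close> is a bounded martingale,
so the variances of its steps have a bounded sum. The increment
\<open>d(s) = \<mu>(s + \<delta>\<^sub>i) - \<mu>(s)\<close> is harmonic too, so by Jensen's inequality each of the first
\<open>n\<close> steps has variance at least \<open>\<alpha>\<^sub>i d(s)\<^sup>2\<close> when the mass stays negative for \<open>n\<close> steps.
Therefore \<open>n \<alpha>\<^sub>i d(s)\<^sup>2\<close> is bounded uniformly in \<open>s\<close>.
\<close>

section \<open>Normal forms in rewriting systems with the diamond property\<close>


text \<open>A step \<open>x \<rightarrow> x'\<close> can be pushed through a path from \<open>x\<close> to a normal form, one diamond at a
  time. The normal form has no outgoing step, so the pushed step must merge with the path at some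
  point, which shortens it by exactly one.\<close>

lemma diamond_length:
  assumes diamond: "\<And>x y z. r x y \<Longrightarrow> r x z \<Longrightarrow> y = z \<or> (\<exists>u. r y u \<and> r z u)"
    and normal: "\<And>z. \<not> r y z"
  shows "(r ^^ n) x y \<Longrightarrow> r x x' \<Longrightarrow> \<exists>m. n = Suc m \<and> (r ^^ m) x' y"
proof (induction n arbitrary: x x')
  case 0
  then show ?case using normal by auto
next
  case (Suc n)
  from Suc.prems(1) obtain z where z: "r x z" "(r ^^ n) z y"
    by (meson relpowp_Suc_E2)
  from diamond[OF z(1) Suc.prems(2)] show ?case
  proof
    assume "z = x'"
    then show ?thesis using z by auto
  next
    assume "\<exists>u. r z u \<and> r x' u"
    then obtain u where u: "r z u" "r x' u" by blast
    from Suc.IH[OF z(2) u(1)] obtain m where "n = Suc m" "(r ^^ m) u y" by blast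
    then have "n = Suc m" "(r ^^ Suc m) x' y" using relpowp_Suc_I2[of r, OF u(2)] by simp_all
    then show ?thesis by blast
  qed
qed

text \<open>All paths from \<open>x\<close> to the normal form have the same length, and every step reduces it.
  This makes one terminating sequence imply that every sequence terminates.\<close>

lemma diamond_terminating:
  assumes diamond: "\<And>x y z. r x y \<Longrightarrow> r x z \<Longrightarrow> y = z \<or> (\<exists>u. r y u \<and> r z u)"
    and normal: "\<And>z. \<not> r y z"
    and "r\<^sup>*\<^sup>* x y"
  shows "termip r x"
proof -
  have "(r ^^ n) x y \<Longrightarrow> termip r x" for n x
  proof (induction n arbitrary: x)
    case 0
    then show ?case using normal by (auto intro: accp.intros)
  next
    case (Suc n)
    show ?case
    proof (rule accp.intros)
      fix x' assume "r\<inverse>\<inverse> x' x"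
      then have "r x x'" by simp
      moreover have "\<exists>m. Suc n = Suc m \<and> (r ^^ m) x' y" if "r x x'"
        by (rule diamond_length[of r, OF _ normal Suc.prems that]) (rule diamond)
      ultimately have "(r ^^ n) x' y" by auto
      then show "termip r x'" by (rule Suc.IH)
    qed
  qed
  then show ?thesis using assms(3) by (auto simp: rtranclp_power)
qed

section \<open>Toppling\<close>

definition topple :: "('v, 'e) pre_digraph \<Rightarrow> 'v \<Rightarrow> ('v \<Rightarrow> int) \<Rightarrow> 'v \<Rightarrow> int" where
  "topple G i s = (\<lambda>j. s j + laplacian G (delta i) j)"

lemma topples_iff:
  "topples G s t \<longleftrightarrow> (\<exists>i \<in> verts G. int (out_degree G i) \<le> s i \<and> t = topple G i s)"
  by (simp add: topples_def topple_def)

lemma topple_other: "j \<noteq> i \<Longrightarrow> s j \<le> topple G i s j"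
  by (auto simp: topple_def laplacian_def delta_def intro!: sum_nonneg)

lemma topple_self: "s i - int (out_degree G i) \<le> topple G i s i"
  by (auto simp: topple_def laplacian_def delta_def intro!: sum_nonneg)

lemma topple_commute: "topple G i (topple G j s) = topple G j (topple G i s)"
  by (simp add: topple_def fun_eq_iff)

lemma topple_mono: "s' j \<le> s j \<Longrightarrow> topple G i s' j \<le> topple G i s j"
  by (simp add: topple_def)

lemma (in fin_digraph) topple_target:
  assumes "e \<in> arcs G" "tail G e = i" "head G e = j" "i \<noteq> j"
  shows "s j + 1 \<le> topple G i s j"
proof -
  have "(1::int) = (\<Sum>e'\<in>{e}. delta i (tail G e'))"
    using assms by (simp add: delta_def)
  also have "\<dots> \<le> (\<Sum>e'\<in>in_arcs G j. delta i (tail G e'))"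
    using assms by (intro sum_mono2) (auto simp: delta_def)
  finally show ?thesis using assms(4) by (simp add: topple_def laplacian_def delta_def)
qed

lemma (in fin_digraph) sum_arcs_by_head:
  fixes f :: "'b \<Rightarrow> 'c::comm_monoid_add"
  shows "A \<subseteq> verts G \<Longrightarrow> (\<Sum>v\<in>A. \<Sum>e\<in>in_arcs G v. f e) = (\<Sum>e | e \<in> arcs G \<and> head G e \<in> A. f e)"
  by (subst sum.UNION_disjoint[symmetric])
     (auto intro!: sum.cong dest: finite_subset)

lemma (in fin_digraph) sum_arcs_by_tail:
  fixes f :: "'b \<Rightarrow> 'c::comm_monoid_add"
  shows "A \<subseteq> verts G \<Longrightarrow> (\<Sum>v\<in>A. \<Sum>e\<in>out_arcs G v. f e) = (\<Sum>e | e \<in> arcs G \<and> tail G e \<in> A. f e)"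
  by (subst sum.UNION_disjoint[symmetric])
     (auto intro!: sum.cong dest: finite_subset)

lemma (in fin_digraph) mass_topple:
  assumes "i \<in> verts G"
  shows "mass G (topple G i s) = mass G s"
proof -
  have "(\<Sum>j\<in>verts G. \<Sum>e\<in>in_arcs G j. delta i (tail G e)) = (\<Sum>e\<in>arcs G. delta i (tail G e))"
    by (subst sum_arcs_by_head) (auto intro!: sum.cong)
  also have "\<dots> = (\<Sum>e\<in>arcs G. if e \<in> out_arcs G i then 1 else 0)"
    by (intro sum.cong) (auto simp: delta_def)
  also have "\<dots> = int (out_degree G i)"
    by (simp add: sum.If_cases out_degree_def) (simp add: out_arcs_def Collect_conj_eq)
  finally have "(\<Sum>j\<in>verts G. \<Sum>e\<in>in_arcs G j. delta i (tail G e)) = int (out_degree G i)" .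
  moreover have "(\<Sum>j\<in>verts G. int (out_degree G j) * delta i j) = int (out_degree G i)"
    using assms by (simp add: delta_def if_distrib cong: if_cong)
  ultimately have "(\<Sum>j\<in>verts G. laplacian G (delta i) j) = 0"
    by (simp add: laplacian_def sum.distrib sum_negf sum_subtractf)
  then show ?thesis by (simp add: mass_def topple_def sum.distrib)
qed

lemma (in fin_digraph) mass_topples: "(topples G)\<^sup>*\<^sup>* s t \<Longrightarrow> mass G t = mass G s"
  by (induction rule: rtranclp_induct) (auto simp: topples_iff mass_topple)

text \<open>Toppling one vertex never lowers another, so two unstable vertices stay unstable whichever is
  toppled first, and the two orders give the same result.\<close>

lemma topples_diamond:
  assumes "topples G s t" "topples G s u"
  shows "t = u \<or> (\<exists>v. topples G t v \<and> topples G u v)"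
proof -
  from assms obtain i j where ij: "i \<in> verts G" "int (out_degree G i) \<le> s i" "t = topple G i s"
      "j \<in> verts G" "int (out_degree G j) \<le> s j" "u = topple G j s"
    by (auto simp: topples_iff)
  show ?thesis
  proof (cases "i = j")
    case False
    then have "int (out_degree G j) \<le> t j" "int (out_degree G i) \<le> u i"
      using ij topple_other[of j i s G] topple_other[of i j s G] by auto
    then have "topples G t (topple G j t)" "topples G u (topple G i u)"
      using ij by (auto simp: topples_iff)
    moreover have "topple G j t = topple G i u" using ij by (simp add: topple_commute)
    ultimately show ?thesis by metis
  qed (use ij in simp)
qed

lemma stable_iff_normal: "stable G s \<longleftrightarrow> (\<forall>t. \<not> topples G s t)"
  by (auto simp: stable_def topples_iff) force

text \<open>Termination, unlike the existence of one stabilizing sequence, is inherited by every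
  simulation; this form is used for monotonicity and for sandpiles of negative mass.\<close>

lemma stabilizable_iff_terminating:
  "stabilizable G s \<longleftrightarrow> termip (topples G) s"
proof
  assume "stabilizable G s"
  then obtain t where "(topples G)\<^sup>*\<^sup>* s t" "stable G t" by (auto simp: stabilizable_def)
  then show "termip (topples G) s"
    using diamond_terminating[of "topples G" t s] topples_diamond
    by (metis stable_iff_normal)
next
  assume "termip (topples G) s"
  then show "stabilizable G s"
  proof (induction rule: accp_induct_rule)
    case (1 s)
    show ?case
    proof (cases "stable G s")
      case False
      then obtain t where t: "topples G s t" by (auto simp: stable_iff_normal)
      then have "stabilizable G t" using 1 by auto
      then show ?thesis using t by (meson stabilizable_def converse_rtranclp_into_rtranclp)
    qed (auto simp: stabilizable_def)
  qed
qed

lemma topples_confluent: "confluentp (topples G)"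
proof (rule strong_confluentp_imp_confluentp, rule strong_confluentpI)
  fix x y z assume "topples G x y" "topples G x z"
  then show "\<exists>u. (topples G)\<^sup>*\<^sup>* y u \<and> (topples G)\<^sup>=\<^sup>= z u"
    using topples_diamond[of G x y z] by blast
qed

lemma stable_topples_eq: "(topples G)\<^sup>*\<^sup>* s t \<Longrightarrow> stable G s \<Longrightarrow> t = s"
  by (erule converse_rtranclpE) (auto simp: stable_iff_normal)

lemma stabilization_eqI:
  assumes "(topples G)\<^sup>*\<^sup>* s t" "stable G t"
  shows "stabilization G s = t"
  unfolding stabilization_def
  using assms confluentpD[OF topples_confluent] stable_topples_eq
  by (intro the_equality) blast+

lemma stabilizable_topples_iff:
  assumes "(topples G)\<^sup>*\<^sup>* s t"
  shows "stabilizable G t \<longleftrightarrow> stabilizable G s"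
proof
  assume "stabilizable G t"
  then show "stabilizable G s"
    using rtranclp_trans[OF assms] unfolding stabilizable_def by blast
next
  assume "stabilizable G s"
  then obtain u where u: "(topples G)\<^sup>*\<^sup>* s u" "stable G u" by (auto simp: stabilizable_def)
  with confluentpD[OF topples_confluent assms u(1)] stable_topples_eq
  show "stabilizable G t" by (metis stabilizable_def)
qed

text \<open>Every toppling that is legal for the smaller sandpile is legal for the larger one and keeps
  their order, so an infinite sequence for the smaller one would give one for the larger.
  The order is required at the vertices of \<open>G\<close> only, and therefore the lemma also shows that
  stabilizability does not see values elsewhere.\<close>

lemma stabilizable_mono:
  assumes "stabilizable G s" "\<And>v. v \<in> verts G \<Longrightarrow> s' v \<le> s v"
  shows "stabilizable G s'"
  unfolding stabilizable_iff_terminating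
  using assms[unfolded stabilizable_iff_terminating]
proof (induction arbitrary: s' rule: accp_induct_rule)
  case (1 s)
  show ?case
  proof (rule accp.intros)
    fix t' assume "(topples G)\<inverse>\<inverse> t' s'"
    then obtain i where i: "i \<in> verts G" "int (out_degree G i) \<le> s' i" "t' = topple G i s'"
      by (auto simp: topples_iff)
    show "termip (topples G) t'"
    proof (rule "1.IH")
      show "(topples G)\<inverse>\<inverse> (topple G i s) s"
        using i "1.prems"[OF i(1)] by (force simp: topples_iff)
      show "t' v \<le> topple G i s v" if "v \<in> verts G" for v
        using i "1.prems"[OF that] by (simp add: topple_mono)
    qed
  qed
qed

section \<open>Mass and stabilizability\<close>

text \<open>The degrees sum to the number of arcs, and a stable sandpile lies below the degrees.\<close>

lemma (in fin_digraph) stabilizable_mass_le: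
  assumes "stabilizable G s"
  shows "mass G s \<le> int (card (arcs G))"
proof -
  from assms obtain t where t: "(topples G)\<^sup>*\<^sup>* s t" "stable G t" by (auto simp: stabilizable_def)
  have "(\<Sum>v\<in>verts G. \<Sum>e\<in>out_arcs G v. (1::nat)) = card (arcs G)"
    by (subst sum_arcs_by_tail) (auto intro!: arg_cong[where f = card])
  then have deg: "(\<Sum>v\<in>verts G. int (out_degree G v)) = int (card (arcs G))"
    by (simp add: out_degree_def flip: of_nat_sum)
  have "mass G s = mass G t" using mass_topples[OF t(1)] by simp
  also have "\<dots> \<le> (\<Sum>v\<in>verts G. int (out_degree G v))"
    using t(2) unfolding mass_def by (intro sum_mono) (force simp: stable_def)
  finally show ?thesis using deg by simp
qed

text \<open>Summing the degrees over \<open>A\<close> shows that as many arcs end in \<open>A\<close> as start in \<open>A\<close>. If no arc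
  leaves \<open>A\<close>, then none enters it either, and \<open>A\<close> is a union of components. In particular a
  connected Eulerian digraph is strongly connected.\<close>

lemma (in fin_digraph) eulerian_closed_eq_verts:
  assumes "Digraph_Component.connected G" "eulerian G"
    and A: "A \<subseteq> verts G" "A \<noteq> {}"
    and closed: "\<And>e. e \<in> arcs G \<Longrightarrow> tail G e \<in> A \<Longrightarrow> head G e \<in> A"
  shows "A = verts G"
proof -
  let ?I = "{e. e \<in> arcs G \<and> head G e \<in> A}" and ?O = "{e. e \<in> arcs G \<and> tail G e \<in> A}"
  have "card ?I = (\<Sum>v\<in>A. in_degree G v)"
    using sum_arcs_by_head[OF A(1), of "\<lambda>_. 1::nat"] by (simp add: in_degree_def)
  also have "\<dots> = (\<Sum>v\<in>A. out_degree G v)"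
    using assms(2) A by (intro sum.cong) (auto simp: eulerian_def)
  also have "\<dots> = card ?O"
    using sum_arcs_by_tail[OF A(1), of "\<lambda>_. 1::nat"] by (simp add: out_degree_def)
  finally have eq: "?O = ?I"
    using closed by (intro card_subset_eq) auto
  have "v \<in> A" if v: "v \<in> verts G" for v
  proof -
    from A obtain u where u: "u \<in> A" by blast
    then have "(u, v) \<in> rtrancl_on (verts G) ((arcs_ends G)\<^sup>s)"
      using assms(1) A v by (auto simp: connected_conv)
    then show ?thesis
    proof (induction rule: rtrancl_on_induct)
      case (step y z)
      then obtain e where "e \<in> arcs G" "(tail G e, head G e) = (y, z) \<or> (tail G e, head G e) = (z, y)"
        by (auto simp: symcl_def arcs_ends_conv)
      then show ?case using eq step by blast
    qed (use u in auto)
  qed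
  then show ?thesis using A by auto
qed

text \<open>In an infinite toppling sequence the values are bounded: from below because only unstable
  vertices lose grains, from above because the mass is constant. Hence a vertex that receives grains
  infinitely often topples infinitely often, and by connectedness every vertex topples. But a vertex
  that has toppled is nonnegative from then on, so the mass is nonnegative.\<close>

lemma (in fin_digraph) mass_neg_stabilizable:
  assumes "Digraph_Component.connected G" "eulerian G" "mass G s < 0"
  shows "stabilizable G s"
proof (rule ccontr)
  assume "\<not> stabilizable G s"
  then have nacc: "\<not> termip (topples G) s"
    by (simp add: stabilizable_iff_terminating)
  have "\<exists>f. \<forall>n. (\<not> termip (topples G) (f n) \<and> (n = 0 \<longrightarrow> f n = s)) \<and> topples G (f n) (f (Suc n))"
  proof (rule dependent_nat_choice)
    show "\<exists>x. \<not> termip (topples G) x \<and> (0 = (0::nat) \<longrightarrow> x = s)" using nacc by blast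
  next
    fix x and n :: nat assume "\<not> termip (topples G) x \<and> (n = 0 \<longrightarrow> x = s)"
    then show "\<exists>y. (\<not> termip (topples G) y \<and> (Suc n = 0 \<longrightarrow> y = s)) \<and> topples G x y"
      by (metis conversepD not_accp_down nat.distinct(1))
  qed
  then obtain f where f: "f 0 = s" "\<And>n. topples G (f n) (f (Suc n))" by blast
  from f(2) have "\<exists>a. \<forall>n. a n \<in> verts G \<and> int (out_degree G (a n)) \<le> f n (a n) \<and> f (Suc n) = topple G (a n) (f n)"
    unfolding topples_iff by metis
  then obtain a where a: "\<And>n. a n \<in> verts G" "\<And>n. int (out_degree G (a n)) \<le> f n (a n)"
      "\<And>n. f (Suc n) = topple G (a n) (f n)" by blast
  have mono: "f n v \<le> f (Suc n) v" if "a n \<noteq> v" for n v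
    using topple_other[of v "a n"] that by (simp add: a(3))
  have nonneg: "0 \<le> f (Suc n) (a n)" for n
    using topple_self[where s = "f n" and i = "a n" and G = G] a(2)[of n] unfolding a(3) by linarith
  \<comment> \<open>A later toppling of the same vertex leaves it nonnegative; all other topplings only raise it.\<close>
  have stays_nonneg: "0 \<le> f (Suc k + n) (a k)" for k n
  proof (induction n)
    case (Suc n)
    show ?case
    proof (cases "a (Suc k + n) = a k")
      case True
      then show ?thesis using nonneg[of "Suc k + n"] by simp
    next
      case False
      then show ?thesis using mono[of "Suc k + n" "a k"] Suc by simp
    qed
  qed (simp add: nonneg)
  have lower: "min 0 (s v) \<le> f n v" for n v
  proof (induction n)
    case (Suc n)
    then show ?case using mono[of n v] nonneg[of n] by (cases "a n = v") auto
  qed (use f(1) in simp)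
  have mass_f: "mass G (f n) = mass G s" for n
    by (induction n) (simp_all add: f(1) a(3) mass_topple[OF a(1)])
  have upper: "f n v \<le> mass G s - (\<Sum>w\<in>verts G - {v}. min 0 (s w))" if "v \<in> verts G" for n v
  proof -
    have "mass G (f n) = f n v + (\<Sum>w\<in>verts G - {v}. f n w)"
      unfolding mass_def by (rule sum.remove[OF finite_verts that])
    then have "mass G s = f n v + (\<Sum>w\<in>verts G - {v}. f n w)" by (simp only: mass_f)
    moreover have "(\<Sum>w\<in>verts G - {v}. min 0 (s w)) \<le> (\<Sum>w\<in>verts G - {v}. f n w)"
      by (intro sum_mono lower)
    ultimately show ?thesis by linarith
  qed
  \<comment> \<open>The vertices that topple infinitely often; finiteness of the graph makes this nonempty.\<close>
  define A where "A = {v \<in> verts G. \<exists>\<^sub>\<infinity>n. a n = v}"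
  have "A = verts G"
  proof (rule eulerian_closed_eq_verts[OF assms(1,2)])
    have "finite (range a)" using a(1) by (intro finite_subset[OF _ finite_verts]) auto
    then obtain k where "infinite {n. a n = a k}"
      using pigeonhole_infinite[of "UNIV :: nat set" a] by auto
    then show "A \<noteq> {}" using a(1)[of k] by (auto simp: A_def frequently_cofinite)
    fix e assume e: "e \<in> arcs G" "tail G e \<in> A"
    show "head G e \<in> A"
    proof (rule ccontr)
      assume "head G e \<notin> A"
      then obtain N where N: "\<And>n. n \<ge> N \<Longrightarrow> a n \<noteq> head G e"
        using e by (auto simp: A_def INFM_nat_le)
      have mono_N: "f n (head G e) \<le> f (n + k) (head G e)" if "n \<ge> N" for n k
      proof (induction k)
        case (Suc k)
        then show ?case using mono[of "n + k" "head G e"] N[of "n + k"] that by simp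
      qed simp
      \<comment> \<open>If the head of the arc \<open>e\<close> stopped toppling, it could only grow, and it would receive a
        grain at each of the infinitely many topplings of the tail.\<close>
      have growth: "\<exists>n\<ge>N. int k + f N (head G e) \<le> f n (head G e)" for k
      proof (induction k)
        case (Suc k)
        then obtain n where n: "n \<ge> N" "int k + f N (head G e) \<le> f n (head G e)" by blast
        obtain m where m: "n + m \<ge> n" "a (n + m) = tail G e"
          using e(2) by (auto simp: A_def INFM_nat_le) (metis le_iff_add)
        have "f (n + m) (head G e) + 1 \<le> f (Suc (n + m)) (head G e)"
          unfolding a(3)[of "n + m"] using m(2) e N[of "n + m"] n(1)
          by (intro topple_target[OF e(1)]) auto
        then show ?case using mono_N[OF n(1), of m] n
          by (intro exI[of _ "Suc (n + m)"]) auto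
      qed auto
      define U where "U = mass G s - (\<Sum>w\<in>verts G - {head G e}. min 0 (s w))"
      have "head G e \<in> verts G" using e(1) by simp
      then have "f n (head G e) \<le> U" for n unfolding U_def by (rule upper)
      moreover obtain n where "int (nat (U - f N (head G e) + 1)) + f N (head G e) \<le> f n (head G e)"
        using growth by blast
      ultimately show False by (smt (verit) int_nat_eq)
    qed
  qed (auto simp: A_def)
  then have "\<forall>v\<in>verts G. \<exists>k. a k = v" by (force simp: A_def INFM_nat_le)
  then obtain k where k: "\<And>v. v \<in> verts G \<Longrightarrow> a (k v) = v" by metis
  define n where "n = Suc (Max (k ` verts G))"
  have "0 \<le> f n v" if "v \<in> verts G" for v
  proof -
    have "k v \<le> Max (k ` verts G)" using that by simp
    then show ?thesis using stays_nonneg[of "k v" "n - Suc (k v)"] k[OF that] by (simp add: n_def)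
  qed
  then have "0 \<le> mass G (f n)" by (auto simp: mass_def intro: sum_nonneg)
  then show False using mass_f assms(3) by simp
qed

section \<open>Bounded harmonic functions\<close>

lemma weighted_sum_of_squares:
  fixes w f :: "'j \<Rightarrow> real"
  assumes "sum w V = 1" "m = (\<Sum>j\<in>V. w j * f j)"
  shows "(\<Sum>j\<in>V. w j * (f j)\<^sup>2) = m\<^sup>2 + (\<Sum>j\<in>V. w j * (f j - m)\<^sup>2)"
proof -
  have "(\<Sum>j\<in>V. w j * (f j - m)\<^sup>2) = (\<Sum>j\<in>V. w j * (f j)\<^sup>2 - 2 * m * (w j * f j) + m\<^sup>2 * w j)"
    by (intro sum.cong) (auto simp: power2_eq_square algebra_simps)
  also have "\<dots> = (\<Sum>j\<in>V. w j * (f j)\<^sup>2) - 2 * m * m + m\<^sup>2 * 1"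
    by (simp only: sum.distrib sum_subtractf flip: sum_distrib_left assms)
  finally show ?thesis by (simp add: power2_eq_square)
qed

text \<open>Averaging the bound for \<open>n\<close> over the successors of \<open>s\<close> gives the bound for \<open>n + 1\<close> at \<open>s\<close>.
  The average of \<open>\<mu>\<^sup>2\<close> exceeds \<open>(\<mu> s)\<^sup>2\<close> by the variance of one step, and the step \<open>i\<close> alone
  contributes \<open>w i * d\<^sup>2\<close> to that variance, where \<open>d\<close> is the increment in direction \<open>i\<close>. Since
  the steps commute, \<open>d\<close> is harmonic, so the average of \<open>d\<^sup>2\<close> is at least \<open>d\<^sup>2\<close>. Iterating over
  \<open>n\<close> levels, a fixed nonzero increment would make \<open>\<mu>\<close> unbounded.\<close>

lemma harmonic_increment_bound:
  fixes \<mu> :: "'s \<Rightarrow> real" and w :: "'j \<Rightarrow> real" and step :: "'j \<Rightarrow> 's \<Rightarrow> 's" and level :: "'s \<Rightarrow> int"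
  assumes "finite V" "i \<in> V" and w: "\<And>j. j \<in> V \<Longrightarrow> 0 \<le> w j" "sum w V = 1"
    and level: "\<And>j s. j \<in> V \<Longrightarrow> level (step j s) = level s + 1"
    and commute: "\<And>j k s. step j (step k s) = step k (step j s)"
    and harmonic: "\<And>s. level s < 0 \<Longrightarrow> \<mu> s = (\<Sum>j\<in>V. w j * \<mu> (step j s))"
    and bound: "\<And>s. level s \<le> 0 \<Longrightarrow> (\<mu> s)\<^sup>2 \<le> C"
  shows "level s + int n < 0 \<Longrightarrow> (\<mu> s)\<^sup>2 + real n * w i * (\<mu> (step i s) - \<mu> s)\<^sup>2 \<le> C"
proof (induction n arbitrary: s)
  case 0
  then show ?case using bound by simp
next
  case (Suc n)
  define d where "d s = \<mu> (step i s) - \<mu> s" for s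
  have d_harmonic: "d s = (\<Sum>j\<in>V. w j * d (step j s))"
    using harmonic[of s] harmonic[of "step i s"] Suc.prems level[OF assms(2)]
    by (simp add: d_def sum_subtractf right_diff_distrib commute[of i])
  have "w i * (d s)\<^sup>2 \<le> (\<Sum>j\<in>V. w j * (\<mu> (step j s) - \<mu> s)\<^sup>2)"
    unfolding d_def by (rule member_le_sum) (use assms in auto)
  moreover have "(\<Sum>j\<in>V. w j * (\<mu> (step j s))\<^sup>2) = (\<mu> s)\<^sup>2 + (\<Sum>j\<in>V. w j * (\<mu> (step j s) - \<mu> s)\<^sup>2)"
    using Suc.prems by (intro weighted_sum_of_squares w harmonic) simp
  moreover have "(d s)\<^sup>2 \<le> (\<Sum>j\<in>V. w j * (d (step j s))\<^sup>2)"
    unfolding weighted_sum_of_squares[OF w(2) d_harmonic] using w(1) by (simp add: sum_nonneg)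
  then have "real n * w i * (d s)\<^sup>2 \<le> real n * w i * (\<Sum>j\<in>V. w j * (d (step j s))\<^sup>2)"
    using w(1)[OF assms(2)] by (intro mult_left_mono) auto
  ultimately have "(\<mu> s)\<^sup>2 + real (Suc n) * w i * (d s)\<^sup>2
      \<le> (\<Sum>j\<in>V. w j * (\<mu> (step j s))\<^sup>2) + real n * w i * (\<Sum>j\<in>V. w j * (d (step j s))\<^sup>2)"
    by (simp add: algebra_simps)
  also have "\<dots> = (\<Sum>j\<in>V. w j * ((\<mu> (step j s))\<^sup>2 + real n * w i * (d (step j s))\<^sup>2))"
    by (simp add: sum.distrib sum_distrib_left distrib_left mult_ac)
  also have "\<dots> \<le> (\<Sum>j\<in>V. w j * C)"
    using Suc.IH Suc.prems level w(1) unfolding d_def by (intro sum_mono mult_left_mono) auto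
  also have "\<dots> = C"
    using w(2) by (simp flip: sum_distrib_right)
  finally show ?case by (simp add: d_def)
qed

section \<open>Adding grains before toppling\<close>

definition grain :: "'v \<Rightarrow> ('v \<Rightarrow> int) \<Rightarrow> 'v \<Rightarrow> int" where
  "grain j s = (\<lambda>v. s v + delta j v)"

text \<open>All grains are dropped first and no vertex is toppled. This replaces the state of the chain,
  because both are stabilizable at the same times and the sum is easier to analyse.\<close>

definition pile :: "('v \<Rightarrow> int) \<Rightarrow> (nat \<Rightarrow> 'v) \<Rightarrow> nat \<Rightarrow> 'v \<Rightarrow> int" where
  "pile s x k = (\<lambda>v. s v + (\<Sum>n=1..k. delta (x n) v))"

lemma pile_0 [simp]: "pile s x 0 = s"
  by (simp add: pile_def)

lemma pile_Suc: "pile s x (Suc k) = grain (x (Suc k)) (pile s x k)"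
  by (simp add: pile_def grain_def fun_eq_iff)

lemma pile_grain: "pile (grain j s) x k = grain j (pile s x k)"
  by (simp add: pile_def grain_def fun_eq_iff)

lemma pile_cong: "(\<And>n. n \<in> {1..k} \<Longrightarrow> x n = y n) \<Longrightarrow> pile s x k = pile s y k"
  by (simp add: pile_def)

lemma grain_commute: "grain j (grain k s) = grain k (grain j s)"
  by (simp add: grain_def fun_eq_iff)

lemma grain_ge: "s v \<le> grain j s v"
  by (simp add: grain_def delta_def)

lemma (in fin_digraph) mass_grain: "j \<in> verts G \<Longrightarrow> mass G (grain j s) = mass G s + 1"
  by (simp add: mass_def grain_def sum.distrib) (simp add: delta_def)

lemma stabilizable_grainD: "stabilizable G (grain j s) \<Longrightarrow> stabilizable G s"
  by (erule stabilizable_mono) (rule grain_ge)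

lemma stabilizable_grain_outside:
  "j \<notin> verts G \<Longrightarrow> stabilizable G (grain j s) \<longleftrightarrow> stabilizable G s"
  by (auto elim!: stabilizable_mono simp: grain_def delta_def)

lemma stabilizable_pile_antimono:
  assumes "stabilizable G (pile s x n)" "m \<le> n"
  shows "stabilizable G (pile s x m)"
  using assms(2,1) by (induction rule: inc_induct) (auto simp: pile_Suc dest: stabilizable_grainD)

lemma topples_grain:
  assumes "(topples G)\<^sup>*\<^sup>* s t"
  shows "(topples G)\<^sup>*\<^sup>* (grain j s) (grain j t)"
  using assms
proof (induction rule: rtranclp_induct)
  case (step t u)
  from step(2) obtain i where i: "i \<in> verts G" "int (out_degree G i) \<le> t i" "u = topple G i t"
    by (auto simp: topples_iff)
  then have "topples G (grain j t) (grain j u)"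
    using grain_ge[of t i j]
    by (auto simp: topples_iff topple_def grain_def fun_eq_iff intro!: bexI[of _ i])
  then show ?case using step.IH by simp
qed simp

text \<open>A toppling stays legal when further grains lie around, so the chain may postpone all its
  topplings until the last grain has been added.\<close>

lemma topples_closed_chain: "(topples G)\<^sup>*\<^sup>* (pile s x k) (closed_chain G s x k)"
proof (induction k)
  case (Suc k)
  let ?j = "x (Suc k)" and ?c = "closed_chain G s x k"
  have "(topples G)\<^sup>*\<^sup>* (pile s x (Suc k)) (grain ?j ?c)"
    unfolding pile_Suc by (rule topples_grain) (rule Suc.IH)
  moreover have "(topples G)\<^sup>*\<^sup>* (grain ?j ?c) (add_grain G ?j ?c)"
    using stabilization_eqI unfolding add_grain_def grain_def[symmetric] Let_def
    by (auto simp: stabilizable_def)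
  ultimately show ?case by simp
qed simp

lemma stabilizable_closed_chain_iff:
  "stabilizable G (closed_chain G s x k) \<longleftrightarrow> stabilizable G (pile s x k)"
  by (rule stabilizable_topples_iff) (rule topples_closed_chain)

text \<open>Once the sandpile is not stabilizable it remains so; the threshold time is therefore detected
  by two consecutive states.\<close>

lemma threshold_time_eq_Suc_iff:
  "threshold_time G s x = enat (Suc m) \<longleftrightarrow>
     stabilizable G (pile s x m) \<and> \<not> stabilizable G (pile s x (Suc m))"
proof -
  let ?S = "{enat k | k. \<not> stabilizable G (pile s x k)}"
  have eq: "threshold_time G s x = Inf ?S"
    by (simp add: threshold_time_def stabilizable_closed_chain_iff)
  show ?thesis
  proof
    assume *: "threshold_time G s x = enat (Suc m)"
    then have "?S \<noteq> {}" by (auto simp: eq top_enat_def simp del: not_all)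
    then have "enat (Suc m) \<in> ?S" using * unfolding eq by (metis (lifting) ex_in_conv wellorder_InfI)
    moreover have "enat m \<notin> ?S"
      using Inf_lower[of "enat m" ?S] * unfolding eq by auto
    ultimately show "stabilizable G (pile s x m) \<and> \<not> stabilizable G (pile s x (Suc m))" by auto
  next
    assume *: "stabilizable G (pile s x m) \<and> \<not> stabilizable G (pile s x (Suc m))"
    show "threshold_time G s x = enat (Suc m)"
      unfolding eq
    proof (rule cInf_eq_minimum)
      fix y assume "y \<in> ?S"
      then obtain k where "y = enat k" "\<not> stabilizable G (pile s x k)" by blast
      then show "enat (Suc m) \<le> y"
        using * stabilizable_pile_antimono[of G s x m k] by (cases "k \<le> m") auto
    qed (use * in auto)
  qed
qed

text \<open>The grains take values in a type that may be uncountable, where sums of random grains need not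
  be measurable. The event depends only on which vertex of \<open>G\<close>, if any, receives each grain, and
  conditioning on the last grain yields a finite union. The measurable space is left arbitrary so
  that the lemma serves both on \<open>M\<close> and on the product space of the first \<open>k\<close> draws.\<close>

lemma (in fin_digraph) stabilizable_pile_measurable:
  assumes "\<And>n. n \<in> {1..k} \<Longrightarrow> X n \<in> N \<rightarrow>\<^sub>M count_space UNIV"
  shows "{y \<in> space N. stabilizable G (pile s (\<lambda>n. X n y) k)} \<in> sets N"
  using assms
proof (induction k arbitrary: s)
  case (Suc k)
  let ?B = "\<lambda>s. {y \<in> space N. stabilizable G (pile s (\<lambda>n. X n y) k)}"
    and ?X = "\<lambda>J. X (Suc k) -` J \<inter> space N"
  have eq: "{y \<in> space N. stabilizable G (pile s (\<lambda>n. X n y) (Suc k))}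
      = (\<Union>j\<in>verts G. ?B (grain j s) \<inter> ?X {j}) \<union> (?B s \<inter> ?X (- verts G))"
    by (auto simp: pile_Suc pile_grain stabilizable_grain_outside)
  have B: "?B t \<in> sets N" for t using Suc by auto
  have X: "?X J \<in> sets N" for J using Suc.prems[of "Suc k"] by (rule measurable_sets) auto
  show ?case
    unfolding eq by (intro sets.Un sets.finite_UN sets.Int[OF B X] finite_verts)
qed auto

section \<open>The law of the threshold\<close>

locale driven_sandpile = fin_digraph G + prob_space M
  for G :: "('v, 'e) pre_digraph" and M :: "'w measure" +
  fixes \<alpha> :: "'v pmf" and I :: "nat \<Rightarrow> 'w \<Rightarrow> 'v"
  assumes connected: "Digraph_Component.connected G"
    and eulerian: "eulerian G"
    and support: "set_pmf \<alpha> \<subseteq> verts G"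
    and indep: "indep_vars (\<lambda>_. count_space UNIV) I {1..}"
    and law: "\<And>k. k \<ge> 1 \<Longrightarrow> distr M (count_space UNIV) (I k) = measure_pmf \<alpha>"
begin

lemma I_measurable: "k \<ge> 1 \<Longrightarrow> I k \<in> M \<rightarrow>\<^sub>M count_space UNIV"
  using indep by (auto simp: indep_vars_def)

lemma sum_pmf: "(\<Sum>j\<in>verts G. pmf \<alpha> j) = 1"
  using sum_pmf_eq_1[OF _ support] by simp

lemma prob_I: "k \<ge> 1 \<Longrightarrow> prob (I k -` {j} \<inter> space M) = pmf \<alpha> j"
  using measure_distr[OF I_measurable, of k "{j}"] by (simp add: law measure_pmf_single)

lemma AE_I_in_verts:
  assumes "k \<ge> 1"
  shows "AE \<omega> in M. I k \<omega> \<in> verts G"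
proof (rule AE_distrD[OF I_measurable[OF assms]])
  show "AE x in distr M (count_space UNIV) (I k). x \<in> verts G"
    unfolding law[OF assms] using support by (auto simp: AE_measure_pmf_iff)
qed

definition stab_event :: "('v \<Rightarrow> int) \<Rightarrow> nat \<Rightarrow> 'w set" where
  "stab_event s k = {\<omega> \<in> space M. stabilizable G (pile s (\<lambda>n. I n \<omega>) k)}"

definition survival :: "('v \<Rightarrow> int) \<Rightarrow> nat \<Rightarrow> real" where
  "survival s k = prob (stab_event s k)"

lemma stab_event_sets [measurable]: "stab_event s k \<in> events"
  unfolding stab_event_def by (rule stabilizable_pile_measurable) (auto intro: I_measurable)

text \<open>The event is a function of the first \<open>k\<close> draws, which are independent of the next one.\<close>

lemma prob_stab_event_next_grain:
  "prob (stab_event s k \<inter> (I (Suc k) -` {j} \<inter> space M)) = survival s k * pmf \<alpha> j"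
proof -
  let ?C = "\<lambda>_. count_space UNIV :: 'v measure"
  let ?P = "PiM {1..k} ?C" and ?Q = "PiM {Suc k} ?C"
  let ?A = "{x \<in> space ?P. stabilizable G (pile s x k)}" and ?B = "{x \<in> space ?Q. x (Suc k) = j}"
  let ?X = "\<lambda>\<omega>. restrict (\<lambda>i. I i \<omega>) {1..k}" and ?Y = "\<lambda>\<omega>. restrict (\<lambda>i. I i \<omega>) {Suc k}"
  have "?A \<in> sets ?P"
    by (rule stabilizable_pile_measurable) (auto intro: measurable_component_singleton)
  moreover have "?B = (\<lambda>x. x (Suc k)) -` {j} \<inter> space ?Q" by auto
  then have "?B \<in> sets ?Q"
    using measurable_sets[OF measurable_component_singleton[of "Suc k" "{Suc k}" ?C], of "{j}"] by auto
  moreover have "indep_var ?P ?X ?Q ?Y"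
    by (rule indep_var_restrict[OF indep]) auto
  ultimately have "prob ((\<lambda>\<omega>. (?X \<omega>, ?Y \<omega>)) -` (?A \<times> ?B) \<inter> space M)
      = prob (?X -` ?A \<inter> space M) * prob (?Y -` ?B \<inter> space M)"
    by (intro indep_varD)
  moreover have "?X -` ?A \<inter> space M = stab_event s k"
  proof -
    have "pile s (?X \<omega>) k = pile s (\<lambda>n. I n \<omega>) k" for \<omega> by (rule pile_cong) auto
    then show ?thesis by (simp add: stab_event_def space_PiM vimage_def Int_def conj_commute del: One_nat_def)
  qed
  moreover have "?Y -` ?B \<inter> space M = I (Suc k) -` {j} \<inter> space M"
    by (auto simp: space_PiM)
  moreover have "(\<lambda>\<omega>. (?X \<omega>, ?Y \<omega>)) -` (?A \<times> ?B) \<inter> space M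
      = (?X -` ?A \<inter> space M) \<inter> (?Y -` ?B \<inter> space M)"
    by blast
  ultimately show ?thesis by (simp add: survival_def prob_I)
qed

text \<open>The last grain may as well be added first: the chain then restarts from \<open>grain j s\<close>.\<close>

lemma survival_Suc: "survival s (Suc k) = (\<Sum>j\<in>verts G. pmf \<alpha> j * survival (grain j s) k)"
proof -
  let ?E = "\<lambda>j. stab_event (grain j s) k \<inter> (I (Suc k) -` {j} \<inter> space M)"
  have E_sets: "?E j \<in> events" for j
    using measurable_sets[OF I_measurable, of "Suc k" "{j}"] by auto
  have "survival s (Suc k) = prob (\<Union>j\<in>verts G. ?E j)"
    unfolding survival_def
  proof (rule measure_eq_AE)
    show "AE \<omega> in M. \<omega> \<in> stab_event s (Suc k) \<longleftrightarrow> \<omega> \<in> (\<Union>j\<in>verts G. ?E j)"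
      using AE_I_in_verts[of "Suc k"]
      by (auto simp: stab_event_def pile_Suc pile_grain)
  qed (use E_sets in auto)
  also have "\<dots> = (\<Sum>j\<in>verts G. prob (?E j))"
    using E_sets by (intro finite_measure_finite_Union) (auto simp: disjoint_family_on_def)
  finally show ?thesis by (simp add: prob_stab_event_next_grain mult.commute)
qed

lemma survival_eq_1: "mass G s + int k < 0 \<Longrightarrow> survival s k = 1"
proof (induction k arbitrary: s)
  case 0
  then have "stabilizable G s" by (intro mass_neg_stabilizable connected eulerian) simp
  then show ?case by (simp add: survival_def stab_event_def prob_space)
next
  case (Suc k)
  then show ?case by (simp add: survival_Suc mass_grain sum_pmf cong: sum.cong_simp)
qed

lemma survival_eq_0: "int (card (arcs G)) < mass G s + int k \<Longrightarrow> survival s k = 0"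
proof (induction k arbitrary: s)
  case 0
  then have "\<not> stabilizable G s" using stabilizable_mass_le[of s] by auto
  then show ?case by (simp add: survival_def stab_event_def)
next
  case (Suc k)
  then show ?case by (simp add: survival_Suc mass_grain cong: sum.cong_simp)
qed

text \<open>Since \<open>survival s k\<close> is the probability that the threshold time exceeds \<open>k\<close>, this is the tail
  sum formula for the expected threshold time.\<close>

definition mean_time :: "('v \<Rightarrow> int) \<Rightarrow> real" where
  "mean_time s = (\<Sum>k. survival s k)"

lemma survival_eq_0': "k \<ge> nat (int (card (arcs G)) - mass G s + 1) \<Longrightarrow> survival s k = 0"
  by (rule survival_eq_0) linarith

lemma survival_summable: "summable (survival s)"
  by (rule summable_finite[of "{..<nat (int (card (arcs G)) - mass G s + 1)}"])
     (auto intro!: survival_eq_0')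

lemma mean_time_step:
  assumes "mass G s < 0"
  shows "mean_time s = 1 + (\<Sum>j\<in>verts G. pmf \<alpha> j * mean_time (grain j s))"
proof -
  have "mean_time s = (\<Sum>k. survival s (Suc k)) + survival s 0"
    unfolding mean_time_def using suminf_split_head[OF survival_summable] by simp
  also have "(\<Sum>k. survival s (Suc k)) = (\<Sum>j\<in>verts G. pmf \<alpha> j * mean_time (grain j s))"
    unfolding survival_Suc mean_time_def
    by (subst suminf_sum) (auto intro!: summable_mult survival_summable simp: suminf_mult survival_summable)
  finally show ?thesis using survival_eq_1[of s 0] assms by simp
qed

lemma mean_time_bounds:
  assumes "mass G s \<le> 0"
  shows "- real_of_int (mass G s) \<le> mean_time s"
    and "mean_time s \<le> real (card (arcs G)) + 1 - real_of_int (mass G s)"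
proof -
  have "survival s k = 1" if "k < nat (- mass G s)" for k
    using that by (intro survival_eq_1) linarith
  then have "(\<Sum>k<nat (- mass G s). 1) = (\<Sum>k<nat (- mass G s). survival s k)"
    by simp
  also have "\<dots> \<le> mean_time s"
    unfolding mean_time_def by (intro sum_le_suminf survival_summable) (auto simp: survival_def)
  finally show "- real_of_int (mass G s) \<le> mean_time s" using assms by simp
  have "mean_time s = (\<Sum>k<nat (int (card (arcs G)) - mass G s + 1). survival s k)"
    unfolding mean_time_def by (rule suminf_finite) (auto intro!: survival_eq_0')
  also have "\<dots> \<le> (\<Sum>k<nat (int (card (arcs G)) - mass G s + 1). 1)"
    by (intro sum_mono) (simp add: survival_def)
  finally show "mean_time s \<le> real (card (arcs G)) + 1 - real_of_int (mass G s)"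
    using assms by simp
qed

text \<open>Each step of the chain adds one unit of mass and topplings conserve it, so the mass at the
  threshold is the initial mass plus the threshold time.\<close>

definition mean_threshold_mass :: "('v \<Rightarrow> int) \<Rightarrow> real" where
  "mean_threshold_mass s = real_of_int (mass G s) + mean_time s"

text \<open>The unit of time that passes in a step is offset by the unit of mass that the grain brings.\<close>

lemma mean_threshold_mass_harmonic:
  assumes "mass G s < 0"
  shows "mean_threshold_mass s = (\<Sum>j\<in>verts G. pmf \<alpha> j * mean_threshold_mass (grain j s))"
proof -
  have "(\<Sum>j\<in>verts G. pmf \<alpha> j * mean_threshold_mass (grain j s))
      = (\<Sum>j\<in>verts G. pmf \<alpha> j * (real_of_int (mass G s) + 1) + pmf \<alpha> j * mean_time (grain j s))"
    by (intro sum.cong) (auto simp: mean_threshold_mass_def mass_grain distrib_left)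
  also have "\<dots> = real_of_int (mass G s) + 1 + (\<Sum>j\<in>verts G. pmf \<alpha> j * mean_time (grain j s))"
    by (simp add: sum.distrib sum_pmf flip: sum_distrib_right)
  finally show ?thesis using mean_time_step[OF assms] by (simp add: mean_threshold_mass_def)
qed

lemma mean_threshold_mass_bound:
  "mass G s \<le> 0 \<Longrightarrow> (mean_threshold_mass s)\<^sup>2 \<le> (real (card (arcs G)) + 1)\<^sup>2"
  using mean_time_bounds[of s] by (intro power_mono) (auto simp: mean_threshold_mass_def)

text \<open>The draw of \<open>i\<close> at time \<open>m + 1\<close> is independent of the event that adding a grain at \<open>i\<close> to the
  first \<open>m\<close> grains destroys stabilizability. By monotonicity that event has probability
  \<open>survival s m - survival (grain i s) m\<close>, and the sum over \<open>m\<close> is a difference of mean times.\<close>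

lemma prob_epicenter:
  "prob {\<omega> \<in> space M. \<exists>k\<ge>1. threshold_time G s (\<lambda>n. I n \<omega>) = enat k \<and> I k \<omega> = i}
    = pmf \<alpha> i * (mean_time s - mean_time (grain i s))"
proof -
  let ?I = "\<lambda>m. I (Suc m) -` {i} \<inter> space M"
  let ?A = "\<lambda>m. stab_event s m \<inter> ?I m" and ?B = "\<lambda>m. stab_event (grain i s) m \<inter> ?I m"
  have sets: "?I m \<in> events" for m
    using measurable_sets[OF I_measurable, of "Suc m" "{i}"] by auto
  have at: "\<omega> \<in> ?A m - ?B m \<longleftrightarrow>
      \<omega> \<in> space M \<and> threshold_time G s (\<lambda>n. I n \<omega>) = enat (Suc m) \<and> I (Suc m) \<omega> = i" for m \<omega>
    by (auto simp: stab_event_def threshold_time_eq_Suc_iff pile_Suc pile_grain)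
  have "{\<omega> \<in> space M. \<exists>k\<ge>1. threshold_time G s (\<lambda>n. I n \<omega>) = enat k \<and> I k \<omega> = i} = (\<Union>m. ?A m - ?B m)"
    (is "?E = _")
  proof (rule set_eqI)
    fix \<omega>
    have "(\<exists>k\<ge>1. P k) \<longleftrightarrow> (\<exists>m. P (Suc m))" for P
      by (metis One_nat_def Suc_le_D Suc_le_mono le0)
    then show "\<omega> \<in> ?E \<longleftrightarrow> \<omega> \<in> (\<Union>m. ?A m - ?B m)"
      unfolding UN_iff at by simp
  qed
  moreover have "(\<lambda>m. prob (?A m - ?B m)) sums prob (\<Union>m. ?A m - ?B m)"
  proof (rule finite_measure_UNION)
    show "disjoint_family (\<lambda>m. ?A m - ?B m)"
      unfolding disjoint_family_on_def
    proof (intro ballI impI equals0I)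
      fix m n \<omega> assume "m \<noteq> n" "\<omega> \<in> (?A m - ?B m) \<inter> (?A n - ?B n)"
      then show False unfolding Int_iff at by (metis enat.inject nat.inject)
    qed
  qed (use sets in auto)
  moreover have "prob (?A m - ?B m) = pmf \<alpha> i * (survival s m - survival (grain i s) m)" for m
  proof -
    have "?B m \<subseteq> ?A m" by (auto simp: stab_event_def pile_grain dest: stabilizable_grainD)
    then have "prob (?A m - ?B m) = prob (?A m) - prob (?B m)"
      using sets by (intro finite_measure_Diff) auto
    then show ?thesis by (simp add: prob_stab_event_next_grain algebra_simps)
  qed
  moreover have "(\<lambda>m. pmf \<alpha> i * (survival s m - survival (grain i s) m))
      sums (pmf \<alpha> i * (mean_time s - mean_time (grain i s)))"
    unfolding mean_time_def
    by (intro sums_mult sums_diff summable_sums survival_summable)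
  ultimately show ?thesis by (metis (no_types, lifting) sums_cong sums_unique2)
qed

text \<open>The deviation from \<open>\<alpha>\<^sub>i\<close> is \<open>- \<alpha>\<^sub>i\<close> times the increment of the mean threshold mass in
  direction \<open>i\<close>: adding the grain itself accounts for the main term \<open>\<alpha>\<^sub>i\<close>.\<close>

lemma prob_epicenter_error:
  assumes "i \<in> verts G" "mass G s + int n < 0"
  shows "real n * pmf \<alpha> i *
    (prob {\<omega> \<in> space M. \<exists>k\<ge>1. threshold_time G s (\<lambda>n. I n \<omega>) = enat k \<and> I k \<omega> = i} - pmf \<alpha> i)\<^sup>2
    \<le> (real (card (arcs G)) + 1)\<^sup>2"
proof -
  let ?\<mu> = mean_threshold_mass
  let ?d = "?\<mu> (grain i s) - ?\<mu> s" and ?a = "pmf \<alpha> i"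
  have bound: "(?\<mu> s)\<^sup>2 + real n * ?a * ?d\<^sup>2 \<le> (real (card (arcs G)) + 1)\<^sup>2"
    by (rule harmonic_increment_bound[where V = "verts G" and level = "mass G" and step = grain])
       (use assms in \<open>auto simp: sum_pmf mass_grain grain_commute
          intro: mean_threshold_mass_harmonic mean_threshold_mass_bound\<close>)
  have error: "prob {\<omega> \<in> space M. \<exists>k\<ge>1. threshold_time G s (\<lambda>n. I n \<omega>) = enat k \<and> I k \<omega> = i} - ?a
      = - (?a * ?d)"
    unfolding prob_epicenter by (simp add: mean_threshold_mass_def mass_grain[OF assms(1)] algebra_simps)
  have "(?a * ?d)\<^sup>2 \<le> ?d\<^sup>2"
    unfolding power_mult_distrib
    by (rule mult_left_le_one_le) (auto simp: pmf_le_1 power_le_one)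
  then have "real n * ?a * (?a * ?d)\<^sup>2 \<le> real n * ?a * ?d\<^sup>2"
    by (intro mult_left_mono) auto
  also have "\<dots> \<le> (real (card (arcs G)) + 1)\<^sup>2"
    using bound zero_le_power2[of "?\<mu> s"] by linarith
  finally show ?thesis unfolding error power2_minus .
qed

end

theorem corollary4:
  fixes G :: "('v, 'e) pre_digraph"
    and \<alpha> :: "'v pmf"
    and M :: "'w measure"
    and I :: "nat \<Rightarrow> 'w \<Rightarrow> 'v"
    and i :: 'v
  assumes "fin_digraph G"
    and "Digraph_Component.connected G"
    and "eulerian G"
    and "set_pmf \<alpha> \<subseteq> verts G"
    and "\<And>j. j \<in> verts G \<Longrightarrow> pmf \<alpha> j > 0"
    and "prob_space M"
    and "prob_space.indep_vars M (\<lambda>_. count_space UNIV) I {1..}"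
    and "\<And>k. k \<ge> 1 \<Longrightarrow> distr M (count_space UNIV) (I k) = measure_pmf \<alpha>"
    and "i \<in> verts G"
  shows "\<forall>\<epsilon>>0. \<exists>K<0. \<forall>s\<^sub>0 :: 'v \<Rightarrow> int. mass G s\<^sub>0 < K \<longrightarrow>
    \<bar>measure M {\<omega> \<in> space M. \<exists>k\<ge>1. threshold_time G s\<^sub>0 (\<lambda>n. I n \<omega>) = enat k \<and> I k \<omega> = i}
      - pmf \<alpha> i\<bar> \<le> \<epsilon>"
proof (intro allI impI)
  fix \<epsilon> :: real assume "\<epsilon> > 0"
  interpret fin_digraph G by fact
  interpret prob_space M by fact
  interpret driven_sandpile G M \<alpha> I
    by unfold_locales (use assms in auto)
  define C where "C = (real (card (arcs G)) + 1)\<^sup>2"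
  have pos: "pmf \<alpha> i * \<epsilon>\<^sup>2 > 0" using assms(5)[OF assms(9)] \<open>\<epsilon> > 0\<close> by simp
  \<comment> \<open>Below mass \<open>- n\<close> the squared error is at most \<open>C / (n * pmf \<alpha> i)\<close>, which is less than \<open>\<epsilon>\<^sup>2\<close>.\<close>
  obtain n where n: "C < real n * (pmf \<alpha> i * \<epsilon>\<^sup>2)"
    using reals_Archimedean3[OF pos] by blast
  have "\<bar>prob {\<omega> \<in> space M. \<exists>k\<ge>1. threshold_time G s (\<lambda>n. I n \<omega>) = enat k \<and> I k \<omega> = i} - pmf \<alpha> i\<bar> \<le> \<epsilon>"
    (is "\<bar>?p\<bar> \<le> \<epsilon>") if "mass G s < - int n - 1" for s
  proof (rule ccontr)
    assume "\<not> \<bar>?p\<bar> \<le> \<epsilon>"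
    then have "\<epsilon>\<^sup>2 \<le> ?p\<^sup>2" using \<open>\<epsilon> > 0\<close> by (intro abs_le_square_iff[THEN iffD1]) simp
    then have "real n * pmf \<alpha> i * \<epsilon>\<^sup>2 \<le> real n * pmf \<alpha> i * ?p\<^sup>2"
      by (intro mult_left_mono) auto
    also have "\<dots> \<le> C"
      unfolding C_def using prob_epicenter_error[OF assms(9)] that by simp
    finally show False using n by (simp add: mult_ac)
  qed
  then show "\<exists>K<0. \<forall>s\<^sub>0. mass G s\<^sub>0 < K \<longrightarrow>
      \<bar>prob {\<omega> \<in> space M. \<exists>k\<ge>1. threshold_time G s\<^sub>0 (\<lambda>n. I n \<omega>) = enat k \<and> I k \<omega> = i} - pmf \<alpha> i\<bar> \<le> \<epsilon>"
    by (intro exI[of _ "- int n - 1"]) auto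
qed

end
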